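(* Let $A$ be a (possibly unbounded) scalar type spectral operator in a complex Banach space $(X,\|\cdot\|)$. If every weak solution of the equation $y'(t)=Ay(t)$, $t\in\mathbb{R}$, is strongly differentiable at $0$, then all of them are strongly infinite differentiable on $\mathbb{R}$ (i.e., belong to $C^\infty(\mathbb{R},X)$).
   Context: Scalar type spectral operator: a densely defined closed linear operator $A$ in a complex Banach space $X$ for which there is a spectral measure (resolution of the identity) $E_A(\cdot)$, i.e., a map assigning to each Borel set $\delta\subseteq\mathbb{C}$ a bounded projection operator $E_A(\delta)$ on $X$ with $E_A(\emptyset)=0$, $E_A(\mathbb{C})=I$ (the identity operator), $E_A(\delta)E_A(\sigma)=E_A(\delta\cap\sigma)$, strongly $\sigma$-additive, with the spectrum $\sigma(A)$ as its support, such that $A=\int_{\sigma(A)}\lambda\,dE_A(\lambda)$, meaning that $D(A)=\{f\in X: \lim_{n\to\infty}\int_{\{|\lambda|\le n\}}\lambda\,dE_A(\lambda)f \text{ exists in } X\}$ and $Af$ is this limit. In general, the integral of a bounded Borel function with respect to $E_A$ is the operator-norm limit of integrals of simple functions. Weak solution: a strongly (i.e., norm) continuous function $y:\mathbb{R}\to X$ is a weak solution of $y'(t)=Ay(t)$, $t\in\mathbb{R}$, if for every $g^*\in D(A^* )$, $\frac{d}{dt}\langle y(t),g^*\rangle=\langle y(t),A^*g^*\rangle$ for all $t\in\mathbb{R}$, where $A^*$ is the adjoint of $A$, $D(\cdot)$ is the domain of an operator, and $\langle\cdot,\cdot\rangle$ is the pairing between $X$ and its dual $X^*$. It need not be strongly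 differentiable. Strong differentiability means differentiability in the norm of $X$. *)

theory Defs
  imports "HOL-Analysis.Analysis"
begin

section \<open>Complex Banach spaces\<close>

class complex_normed_vector = real_normed_vector +
  fixes scaleC :: "complex \<Rightarrow> 'a \<Rightarrow> 'a"  (infixr "*\<^sub>C" 75)
  assumes scaleC_add_right: "c *\<^sub>C (x + y) = c *\<^sub>C x + c *\<^sub>C y"
    and scaleC_add_left: "(c + d) *\<^sub>C x = c *\<^sub>C x + d *\<^sub>C x"
    and scaleC_scaleC: "c *\<^sub>C d *\<^sub>C x = (c * d) *\<^sub>C x"
    and scaleC_one: "1 *\<^sub>C x = x"
    and scaleR_scaleC: "r *\<^sub>R x = complex_of_real r *\<^sub>C x"
    and norm_scaleC: "norm (c *\<^sub>C x) = cmod c * norm x"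

class complex_banach = complex_normed_vector + banach

instantiation complex :: complex_banach
begin

definition scaleC_complex :: "complex \<Rightarrow> complex \<Rightarrow> complex"
  where "scaleC_complex c x = c * x"

instance
  by standard (simp_all add: scaleC_complex_def algebra_simps norm_mult scaleR_conv_of_real)

end

text \<open>
  Since \<open>r *\<^sub>R x = complex_of_real r *\<^sub>C x\<close>, a bounded complex-linear map is a real-linear one
  that commutes with complex scalars, and its operator norm is \<^const>\<open>onorm\<close>.
\<close>

definition bounded_clinear :: "('a::complex_normed_vector \<Rightarrow> 'b::complex_normed_vector) \<Rightarrow> bool"
  where "bounded_clinear T \<longleftrightarrow> bounded_linear T \<and> (\<forall>c x. T (c *\<^sub>C x) = c *\<^sub>C T x)"


section \<open>Unbounded operators\<close>

text \<open>
  An operator is given by its domain \<open>D\<close> and a total function \<open>A\<close> whose values outside \<open>D\<close>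
  are irrelevant.
\<close>

definition linear_operator :: "'a::complex_normed_vector set \<Rightarrow> ('a \<Rightarrow> 'a) \<Rightarrow> bool"
  where "linear_operator D A \<longleftrightarrow>
    0 \<in> D \<and>
    (\<forall>x\<in>D. \<forall>y\<in>D. x + y \<in> D \<and> A (x + y) = A x + A y) \<and>
    (\<forall>c. \<forall>x\<in>D. c *\<^sub>C x \<in> D \<and> A (c *\<^sub>C x) = c *\<^sub>C A x)"

definition densely_defined :: "'a::complex_normed_vector set \<Rightarrow> bool"
  where "densely_defined D \<longleftrightarrow> closure D = UNIV"

definition closed_operator :: "'a::complex_normed_vector set \<Rightarrow> ('a \<Rightarrow> 'a) \<Rightarrow> bool"
  where "closed_operator D A \<longleftrightarrow> closed ((\<lambda>x. (x, A x)) ` D)"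

definition resolvent_set :: "'a::complex_normed_vector set \<Rightarrow> ('a \<Rightarrow> 'a) \<Rightarrow> complex set"
  where "resolvent_set D A =
    {z. bij_betw (\<lambda>x. A x - z *\<^sub>C x) D UNIV \<and>
        bounded_clinear (inv_into D (\<lambda>x. A x - z *\<^sub>C x))}"

definition spectrum :: "'a::complex_normed_vector set \<Rightarrow> ('a \<Rightarrow> 'a) \<Rightarrow> complex set"
  where "spectrum D A = - resolvent_set D A"

definition adjoint_domain ::
    "'a::complex_normed_vector set \<Rightarrow> ('a \<Rightarrow> 'a) \<Rightarrow> ('a \<Rightarrow> complex) set"
  where "adjoint_domain D A =
    {g. bounded_clinear g \<and> (\<exists>h. bounded_clinear h \<and> (\<forall>x\<in>D. g (A x) = h x))}"

definition adjoint_op ::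
    "'a::complex_normed_vector set \<Rightarrow> ('a \<Rightarrow> 'a) \<Rightarrow> ('a \<Rightarrow> complex) \<Rightarrow> ('a \<Rightarrow> complex)"
  where "adjoint_op D A g = (THE h. bounded_clinear h \<and> (\<forall>x\<in>D. g (A x) = h x))"

lemma adjoint_op_eqI:
  fixes h :: "'a::complex_normed_vector \<Rightarrow> complex"
  assumes dense: "densely_defined D"
    and h: "bounded_clinear h" "\<And>x. x \<in> D \<Longrightarrow> g (A x) = h x"
  shows "adjoint_op D A g = h"
  unfolding adjoint_op_def
proof (rule the_equality)
  show "bounded_clinear h \<and> (\<forall>x\<in>D. g (A x) = h x)"
    using h by blast
next
  fix k assume k: "bounded_clinear k \<and> (\<forall>x\<in>D. g (A x) = k x)"
  have cont: "continuous_on UNIV (\<lambda>x. k x - h x)"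
    using k h(1) unfolding bounded_clinear_def
    by (intro continuous_on_diff linear_continuous_on) auto
  have "closed ((\<lambda>x. k x - h x) -` {0})"
    by (intro closed_vimage cont) simp
  moreover have "D \<subseteq> (\<lambda>x. k x - h x) -` {0}"
    using k h(2) by fastforce
  ultimately have "closure D \<subseteq> (\<lambda>x. k x - h x) -` {0}"
    by (rule closure_minimal[rotated])
  then have "\<And>x. k x - h x = 0"
    using dense unfolding densely_defined_def by blast
  then show "k = h"
    by (simp add: fun_eq_iff)
qed


section \<open>Spectral measures and scalar type spectral operators\<close>

text \<open>The values of a spectral measure on non-Borel sets are irrelevant.\<close>

definition spectral_measure :: "(complex set \<Rightarrow> 'a::complex_normed_vector \<Rightarrow> 'a) \<Rightarrow> bool"
  where "spectral_measure E \<longleftrightarrow>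
    (\<forall>\<delta>\<in>sets borel. bounded_clinear (E \<delta>) \<and> E \<delta> \<circ> E \<delta> = E \<delta>) \<and>
    E {} = (\<lambda>x. 0) \<and>
    E UNIV = id \<and>
    (\<forall>\<delta>\<in>sets borel. \<forall>\<sigma>\<in>sets borel. E \<delta> \<circ> E \<sigma> = E (\<delta> \<inter> \<sigma>)) \<and>
    (\<forall>F::nat \<Rightarrow> complex set. range F \<subseteq> sets borel \<longrightarrow> disjoint_family F \<longrightarrow>
      (\<forall>x. (\<lambda>n. E (F n) x) sums E (\<Union>n. F n) x))"

definition spectral_support :: "(complex set \<Rightarrow> 'a::complex_normed_vector \<Rightarrow> 'a) \<Rightarrow> complex set"
  where "spectral_support E = {z. \<forall>U. open U \<longrightarrow> z \<in> U \<longrightarrow> E U \<noteq> (\<lambda>x. 0)}"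

definition simple_spectral_integral ::
    "(complex set \<Rightarrow> 'a::complex_normed_vector \<Rightarrow> 'a) \<Rightarrow> (complex \<Rightarrow> complex) \<Rightarrow> 'a \<Rightarrow> 'a"
  where "simple_spectral_integral E s x = (\<Sum>c\<in>range s. c *\<^sub>C E (s -` {c}) x)"

text \<open>
  \<open>T\<close> is the integral of the bounded Borel function \<open>F\<close>: the operator-norm limit of the
  integrals of simple functions converging uniformly to \<open>F\<close>.
\<close>

definition has_spectral_integral ::
    "(complex set \<Rightarrow> 'a::complex_normed_vector \<Rightarrow> 'a) \<Rightarrow> (complex \<Rightarrow> complex) \<Rightarrow> ('a \<Rightarrow> 'a) \<Rightarrow> bool"
  where "has_spectral_integral E F T \<longleftrightarrow>
    bounded_clinear T \<and>
    (\<exists>s::nat \<Rightarrow> complex \<Rightarrow> complex.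
      (\<forall>n. simple_function borel (s n)) \<and>
      uniform_limit UNIV s F sequentially \<and>
      (\<lambda>n. onorm (\<lambda>x. simple_spectral_integral E (s n) x - T x)) \<longlonglongrightarrow> 0)"

text \<open>
  The operator \<open>T n\<close> below is the integral of \<open>\<lambda>\<close> over \<open>{|\<lambda>| \<le> n}\<close>. As \<open>E\<close> is supported on the
  spectrum, this is the same as integrating over the part of the spectrum in that disc.
\<close>

definition resolution_of_identity ::
    "'a::complex_normed_vector set \<Rightarrow> ('a \<Rightarrow> 'a) \<Rightarrow> (complex set \<Rightarrow> 'a \<Rightarrow> 'a) \<Rightarrow> bool"
  where "resolution_of_identity D A E \<longleftrightarrow>
    spectral_measure E \<and>
    spectral_support E = spectrum D A \<and>
    (\<exists>T::nat \<Rightarrow> 'a \<Rightarrow> 'a.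
      (\<forall>n. has_spectral_integral E (\<lambda>z. if cmod z \<le> real n then z else 0) (T n)) \<and>
      D = {f. convergent (\<lambda>n. T n f)} \<and>
      (\<forall>f\<in>D. (\<lambda>n. T n f) \<longlonglongrightarrow> A f))"

definition scalar_type_spectral_operator ::
    "'a::complex_banach set \<Rightarrow> ('a \<Rightarrow> 'a) \<Rightarrow> bool"
  where "scalar_type_spectral_operator D A \<longleftrightarrow>
    linear_operator D A \<and> densely_defined D \<and> closed_operator D A \<and>
    (\<exists>E. resolution_of_identity D A E)"


section \<open>Weak solutions and smoothness\<close>

definition weak_solution ::
    "'a::complex_normed_vector set \<Rightarrow> ('a \<Rightarrow> 'a) \<Rightarrow> (real \<Rightarrow> 'a) \<Rightarrow> bool"
  where "weak_solution D A y \<longleftrightarrow>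
    continuous_on UNIV y \<and>
    (\<forall>g\<in>adjoint_domain D A. \<forall>t.
      ((\<lambda>s. g (y s)) has_vector_derivative adjoint_op D A g (y t)) (at t))"

definition infinitely_differentiable :: "(real \<Rightarrow> 'a::real_normed_vector) \<Rightarrow> bool"
  where "infinitely_differentiable y \<longleftrightarrow>
    (\<forall>n t. ((\<lambda>f s. vector_derivative f (at s)) ^^ n) y differentiable (at t))"

end

theory Submission imports Defs begin

text \<open>
  The weak solutions form a linear space \<open>W\<close> of continuous functions \<open>\<real> \<rightarrow> X\<close> that is invariant
  under translations, since the equation is autonomous, and closed under locally uniform limits,
  since both sides of \<open>(g \<circ> y)' = (A* g) \<circ> y\<close> then converge locally uniformly for every \<open>g\<close> in the
  domain of the adjoint (\<open>weak_solution_limit\<close>). So \<open>W\<close> is a Frechet space with the seminorms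
  \<open>sup {\<parallel>y t\<parallel> | \<bar>t\<bar> \<le> R}\<close>. Any such space whose members are all differentiable at one point
  consists of smooth functions.

  The reason is the principle of uniform boundedness. The difference quotients
  \<open>(y h - y 0) / h\<close> with \<open>0 < \<bar>h\<bar> \<le> 1\<close> are continuous linear maps on \<open>W\<close>, and they are pointwise
  bounded because every \<open>y \<in> W\<close> is differentiable at \<open>0\<close>. Hence they are equicontinuous
  (\<open>difference_quotient_uniform_bound\<close>): they are bounded by \<open>C\<close> times a single seminorm.

  By translation, each \<open>y \<in> W\<close> is differentiable everywhere. The uniform bound, applied to the
  difference of the translates of \<open>y\<close> by \<open>s\<close> and by \<open>s\<^sub>0\<close>, controls \<open>y' s - y' s\<^sub>0\<close> by the oscillation of
  \<open>y\<close> on a compact interval, so \<open>y'\<close> is continuous (\<open>continuous_on_derivative\<close>). The difference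
  quotients of \<open>y\<close>, which belong to \<open>W\<close>, then converge to \<open>y'\<close> locally uniformly, so
  \<open>y' \<in> W\<close> (\<open>derivative_mem\<close>), and induction gives derivatives of all orders.
\<close>

section \<open>Difference quotients of a single function\<close>

lemma has_vector_derivative_imp_slope_tendsto:
  assumes "(y has_vector_derivative d) (at s)"
  shows "((\<lambda>h. (y (s + h) - y s) /\<^sub>R h) \<longlongrightarrow> d) (at 0)"
proof -
  have "((\<lambda>h. norm (y (s + h) - y s - h *\<^sub>R d) / norm h) \<longlongrightarrow> 0) (at 0)"
    using assms by (simp add: has_vector_derivative_def has_derivative_at)
  then have "((\<lambda>h. norm ((y (s + h) - y s) /\<^sub>R h - d)) \<longlongrightarrow> 0) (at 0)"
  proof (rule Lim_transform_eventually)
    have "norm (y (s + h) - y s - h *\<^sub>R d) / norm h = norm ((y (s + h) - y s) /\<^sub>R h - d)"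
      if "h \<noteq> 0" for h
    proof -
      have "(y (s + h) - y s) /\<^sub>R h - d = (y (s + h) - y s - h *\<^sub>R d) /\<^sub>R h"
        using that by (simp add: scaleR_diff_right)
      then show ?thesis by (simp add: divide_inverse mult.commute)
    qed
    then show "\<forall>\<^sub>F h in at 0. norm (y (s + h) - y s - h *\<^sub>R d) / norm h =
        norm ((y (s + h) - y s) /\<^sub>R h - d)"
      by (simp add: eventually_at_filter)
  qed
  then show ?thesis by (simp add: LIM_zero_iff tendsto_norm_zero_iff)
qed

text \<open>
  The difference quotient, extended by the derivative at \<open>0\<close>, is continuous on the compact
  interval \<open>[-1, 1]\<close>.
\<close>

lemma difference_quotient_bounded:
  fixes y :: "real \<Rightarrow> 'a::real_normed_vector"
  assumes cont: "continuous_on UNIV y" and diff: "y differentiable (at 0)"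
  obtains M where "\<And>h. 0 < \<bar>h\<bar> \<Longrightarrow> \<bar>h\<bar> \<le> 1 \<Longrightarrow> norm (y h - y 0) / \<bar>h\<bar> \<le> M"
proof -
  obtain d where "(y has_vector_derivative d) (at 0)"
    using diff vector_derivative_works by blast
  then have lim: "(\<lambda>h. (y h - y 0) /\<^sub>R h) \<midarrow>0\<rightarrow> d"
    using has_vector_derivative_imp_slope_tendsto[of y d 0] by simp
  define q where "q h = (if h = 0 then d else (y h - y 0) /\<^sub>R h)" for h
  have "isCont q h" for h
  proof (cases "h = 0")
    case True
    have "q \<midarrow>0\<rightarrow> d"
      using lim by (rule Lim_transform_eventually) (auto simp: q_def eventually_at_filter)
    then show ?thesis using True by (simp add: isCont_def q_def)
  next
    case False
    have "isCont y h" using cont by (simp add: continuous_on_eq_continuous_at)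
    then have "isCont (\<lambda>h. (y h - y 0) /\<^sub>R h) h" using False by (intro continuous_intros) auto
    moreover have "eventually (\<lambda>x. x \<noteq> 0) (nhds h)"
      using False t1_space_nhds by blast
    then have "eventually (\<lambda>x. (y x - y 0) /\<^sub>R x = q x) (nhds h)"
      by eventually_elim (simp add: q_def)
    ultimately show ?thesis
      using isCont_cong[of "\<lambda>h. (y h - y 0) /\<^sub>R h" q h] by simp
  qed
  then have "bounded (q ` {-1..1})"
    by (intro compact_imp_bounded compact_continuous_image)
      (auto intro: continuous_at_imp_continuous_on)
  then obtain M where "\<forall>x\<in>q ` {-1..1}. norm x \<le> M"
    unfolding bounded_iff ..
  then have M: "norm (q h) \<le> M" if "h \<in> {-1..1}" for h
    using that by simp
  show thesis
  proof
    fix h :: real assume h: "0 < \<bar>h\<bar>" "\<bar>h\<bar> \<le> 1"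
    then show "norm (y h - y 0) / \<bar>h\<bar> \<le> M"
      using M[of h] by (simp add: q_def divide_inverse mult.commute abs_le_iff)
  qed
qed

section \<open>Translation invariant spaces of functions differentiable at a point\<close>

text \<open>
  The assumption \<open>limit\<close> makes \<open>W\<close> a closed subspace of the Frechet space of all continuous
  functions, and it is what replaces completeness in the Baire-type argument below.
\<close>

locale translation_invariant_space =
  fixes W :: "(real \<Rightarrow> 'a::banach) set"
  assumes continuous: "y \<in> W \<Longrightarrow> continuous_on UNIV y"
    and zero: "(\<lambda>t. 0) \<in> W"
    and lincomb: "y \<in> W \<Longrightarrow> z \<in> W \<Longrightarrow> (\<lambda>t. a *\<^sub>R y t + b *\<^sub>R z t) \<in> W"
    and translate: "y \<in> W \<Longrightarrow> (\<lambda>t. y (t + s)) \<in> W"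
    and limit: "(\<And>n. u n \<in> W) \<Longrightarrow> (\<And>T. uniform_limit {-T..T} u y sequentially) \<Longrightarrow> y \<in> W"
    and differentiable_at_0: "y \<in> W \<Longrightarrow> y differentiable (at 0)"
begin

lemma scale: "y \<in> W \<Longrightarrow> (\<lambda>t. a *\<^sub>R y t) \<in> W"
  using lincomb[of y y a 0] by simp

lemma diff: "y \<in> W \<Longrightarrow> z \<in> W \<Longrightarrow> (\<lambda>t. y t - z t) \<in> W"
  using lincomb[of y z 1 "-1"] by simp

text \<open>
  The radius \<open>Suc n\<close> ensures that all step sizes \<open>\<bar>h\<bar> \<le> 1\<close> lie in the controlled interval, so that
  each single difference quotient is bounded on each of these balls.
\<close>

definition unit_ball :: "nat \<Rightarrow> (real \<Rightarrow> 'a) set"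
  where "unit_ball n = {z \<in> W. \<forall>t\<in>{-real (Suc n)..real (Suc n)}. norm (z t) \<le> 1}"

lemma zero_in_unit_ball: "(\<lambda>t. 0) \<in> unit_ball n"
  by (simp add: unit_ball_def zero)

lemma scaled_quotient_le:
  assumes ball: "\<And>z. z \<in> unit_ball n \<Longrightarrow> norm (z h - z 0) / \<bar>h\<bar> \<le> N"
    and y: "y \<in> W" and B: "0 < B"
    and bound: "\<And>t. t \<in> {-real (Suc n)..real (Suc n)} \<Longrightarrow> norm (y t) \<le> B"
  shows "norm (y h - y 0) / \<bar>h\<bar> \<le> B * N"
proof -
  have "(\<lambda>t. y t /\<^sub>R B) \<in> unit_ball n"
    using scale[OF y, of "inverse B"] bound B by (auto simp: unit_ball_def field_simps)
  from ball[OF this] have "norm (y h - y 0) / B / \<bar>h\<bar> \<le> N"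
    using B by (simp add: divide_inverse mult.commute flip: scaleR_diff_right)
  then have "B * (norm (y h - y 0) / \<bar>h\<bar> / B) \<le> B * N"
    using B by (intro mult_left_mono) (simp_all add: mult.commute)
  then show ?thesis using B by simp
qed

text \<open>
  Uniform boundedness by a gliding hump, following Sokal's elementary proof. If the claim fails,
  then for each \<open>n\<close> there is a step \<open>h n\<close> whose difference quotient has a huge supremum \<open>N n\<close>
  over the \<open>n\<close>-th unit ball. Add up functions \<open>\<plusminus>z n / 3 ^ n\<close>, where \<open>z n\<close> nearly attains \<open>N n\<close>. The
  signs are chosen such that the earlier summands cannot cancel the new one; the later ones have
  total size at most \<open>1 / (2 * 3 ^ n)\<close> in the \<open>n\<close>-th seminorm and so spoil at most
  \<open>N n / (2 * 3 ^ n)\<close> of the \<open>2 / 3 * N n / 3 ^ n\<close> reached. What is left, \<open>N n / (6 * 3 ^ n)\<close>,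
  still tends to infinity, against the differentiability of the sum at \<open>0\<close>.
\<close>

lemma unit_ball_quotients_bounded:
  "\<exists>n C. \<forall>z\<in>unit_ball n. \<forall>h. 0 < \<bar>h\<bar> \<longrightarrow> \<bar>h\<bar> \<le> 1 \<longrightarrow> norm (z h - z 0) / \<bar>h\<bar> \<le> C"
proof (rule ccontr)
  define Q where "Q h z = norm (z h - z 0) / \<bar>h\<bar>" for h and z :: "real \<Rightarrow> 'a"
  assume "\<not> ?thesis"
  then have "\<forall>n. \<exists>h. 0 < \<bar>h\<bar> \<and> \<bar>h\<bar> \<le> 1 \<and> (\<exists>z\<in>unit_ball n. 6 * 3 ^ n * (real n + 1) < Q h z)"
    by (force simp: Q_def not_le)
  then obtain h where h: "\<And>n. 0 < \<bar>h n\<bar>" "\<And>n. \<bar>h n\<bar> \<le> 1"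
    and large: "\<And>n. \<exists>z\<in>unit_ball n. 6 * 3 ^ n * (real n + 1) < Q (h n) z"
    by metis
  define N where "N n = (SUP z\<in>unit_ball n. Q (h n) z)" for n
  have bdd: "bdd_above (Q (h n) ` unit_ball n)" for n
  proof (rule bdd_aboveI2)
    fix z assume "z \<in> unit_ball n"
    then have "norm (z (h n)) \<le> 1" "norm (z 0) \<le> 1"
      using h(2)[of n] by (auto simp: unit_ball_def abs_le_iff)
    then have "norm (z (h n) - z 0) \<le> 2"
      using norm_triangle_ineq4[of "z (h n)" "z 0"] by linarith
    then show "Q (h n) z \<le> 2 / \<bar>h n\<bar>"
      using h(1)[of n] by (auto simp: Q_def intro: divide_right_mono)
  qed
  have Q_le_N: "Q (h n) z \<le> N n" if "z \<in> unit_ball n" for n z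
    unfolding N_def using that bdd by (rule cSUP_upper)
  have N_large: "6 * 3 ^ n * (real n + 1) < N n" for n
    using large[of n] Q_le_N[of _ n] by force
  have N_pos: "0 < N n" for n
    using N_large[of n] by (smt (verit) mult_pos_pos of_nat_0_le_iff zero_less_power)
  have "\<forall>n. \<exists>z\<in>unit_ball n. 2 / 3 * N n < Q (h n) z"
  proof
    fix n
    have "2 / 3 * N n < (SUP z\<in>unit_ball n. Q (h n) z)"
      using N_pos[of n] by (simp add: N_def[symmetric])
    then show "\<exists>z\<in>unit_ball n. 2 / 3 * N n < Q (h n) z"
      by (subst (asm) less_cSUP_iff) (use bdd zero_in_unit_ball in auto)
  qed
  then obtain z where z: "\<And>n. z n \<in> unit_ball n" and Qz: "\<And>n. 2 / 3 * N n < Q (h n) (z n)"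
    by metis
  have zW: "z n \<in> W" for n using z[of n] by (simp add: unit_ball_def)
  have z1: "norm (z n t) \<le> 1" if "t \<in> {-real (Suc n)..real (Suc n)}" for n t
    using z[of n] that by (simp add: unit_ball_def)
  have "\<exists>x. \<forall>n. (x n \<in> W \<and> True) \<and>
      ((\<exists>\<sigma>\<in>{1, -1}. x (Suc n) = (\<lambda>t. x n t + (\<sigma> / 3 ^ n) *\<^sub>R z n t)) \<and>
       2 / 3 * N n / 3 ^ n < Q (h n) (x (Suc n)))"
  proof (rule dependent_nat_choice)
    show "\<exists>x. x \<in> W \<and> True" using zero by blast
  next
    fix x n assume x: "x \<in> W \<and> True"
    define v where "v \<sigma> = (\<lambda>t. x t + (\<sigma> / 3 ^ n) *\<^sub>R z n t)" for \<sigma> :: real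
    have vW: "v \<sigma> \<in> W" for \<sigma>
      using lincomb[of x "z n" 1 "\<sigma> / 3 ^ n"] x zW by (simp add: v_def)
    define a b where "a = x (h n) - x 0" and "b = (1 / 3 ^ n) *\<^sub>R (z n (h n) - z n 0)"
    \<comment> \<open>Since \<open>2 * b = (a + b) - (a - b)\<close>, one of the two signs does not decrease the quotient
      below that of the new summand.\<close>
    have "2 * norm b \<le> norm (a + b) + norm (a - b)"
      using norm_triangle_ineq4[of "a + b" "a - b"] by (simp add: scaleR_2[symmetric])
    then have "norm b \<le> norm (a + b) \<or> norm b \<le> norm (a - b)" by linarith
    moreover have "v 1 (h n) - v 1 0 = a + b" "v (-1) (h n) - v (-1) 0 = a - b"
      by (simp_all add: v_def a_def b_def algebra_simps)
    ultimately have "\<exists>\<sigma>\<in>{1, -1}. norm b \<le> norm (v \<sigma> (h n) - v \<sigma> 0)" by auto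
    then obtain \<sigma> :: real where \<sigma>: "\<sigma> \<in> {1, -1}" "norm b \<le> norm (v \<sigma> (h n) - v \<sigma> 0)" by blast
    have "2 / 3 * N n / 3 ^ n < Q (h n) (z n) / 3 ^ n"
      using Qz[of n] by (intro divide_strict_right_mono) auto
    also have "\<dots> = norm b / \<bar>h n\<bar>" by (simp add: Q_def b_def)
    also have "\<dots> \<le> Q (h n) (v \<sigma>)" using \<sigma>(2) by (simp add: Q_def divide_right_mono)
    finally show "\<exists>y. (y \<in> W \<and> True) \<and> ((\<exists>\<sigma>\<in>{1, -1}. y = (\<lambda>t. x t + (\<sigma> / 3 ^ n) *\<^sub>R z n t)) \<and>
       2 / 3 * N n / 3 ^ n < Q (h n) y)"
      using vW[of \<sigma>] \<sigma>(1) unfolding v_def by blast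
  qed
  then obtain x where xW: "\<And>n. x n \<in> W"
    and x_Suc: "\<And>n. \<exists>\<sigma>\<in>{1, -1}. x (Suc n) = (\<lambda>t. x n t + (\<sigma> / 3 ^ n) *\<^sub>R z n t)"
    and Qx: "\<And>n. 2 / 3 * N n / 3 ^ n < Q (h n) (x (Suc n))"
    by blast
  define f where "f n t = x (Suc n) t - x n t" for n t
  have f_le: "norm (f n t) \<le> (1 / 3) ^ n" if "t \<in> {-real (Suc n)..real (Suc n)}" for n t
  proof -
    obtain \<sigma> :: real where "\<sigma> \<in> {1, -1}" "x (Suc n) = (\<lambda>t. x n t + (\<sigma> / 3 ^ n) *\<^sub>R z n t)"
      using x_Suc by blast
    then have "norm (f n t) = norm (z n t) / 3 ^ n" by (auto simp: f_def)
    also have "\<dots> \<le> 1 / 3 ^ n" using z1[OF that] by (intro divide_right_mono) auto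
    finally show ?thesis by (simp add: power_one_over)
  qed
  have x_eq: "x n t = x 0 t + (\<Sum>i<n. f i t)" for n t
    by (induction n) (simp_all add: f_def)
  define l where "l t = x 0 t + (\<Sum>i. f i t)" for t
  have unif: "uniform_limit {-T..T} x l sequentially" for T
  proof -
    obtain m where m: "T \<le> real m" using real_arch_simple by blast
    have "eventually (\<lambda>n. \<forall>t\<in>{-T..T}. norm (f n t) \<le> (1 / 3) ^ n) sequentially"
      \<comment> \<open>Only the summands from index \<open>m\<close> on are controlled on the whole of \<open>{-T..T}\<close>.\<close>
      using eventually_ge_at_top[of m]
    proof eventually_elim
      case (elim n)
      then have "T \<le> real (Suc n)" using m by linarith
      then show ?case by (auto intro!: f_le)
    qed
    then have "uniform_limit {-T..T} (\<lambda>n t. \<Sum>i<n. f i t) (\<lambda>t. \<Sum>i. f i t) sequentially"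
      by (rule Weierstrass_m_test_ev) (simp add: summable_geometric)
    then have "uniform_limit {-T..T} (\<lambda>n t. x 0 t + (\<Sum>i<n. f i t)) l sequentially"
      unfolding l_def by (intro uniform_limit_intros)
    moreover have "x = (\<lambda>n t. x 0 t + (\<Sum>i<n. f i t))" by (intro ext x_eq)
    ultimately show ?thesis by simp
  qed
  have lW: "l \<in> W" using xW unif by (rule limit)
  have tail: "norm (l t - x (Suc n) t) \<le> 1 / (2 * 3 ^ n)"
    if t: "t \<in> {-real (Suc n)..real (Suc n)}" for n t
  proof -
    have geo: "norm (f (i + Suc n) t) \<le> (1 / 3) ^ i * (1 / 3) ^ Suc n" for i
    proof -
      have "norm (f (i + Suc n) t) \<le> (1 / 3) ^ (i + Suc n)" using t by (intro f_le) auto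
      then show ?thesis by (simp only: power_add)
    qed
    have S: "(\<lambda>i. (1 / 3 :: real) ^ i * (1 / 3) ^ Suc n) sums (1 / (1 - 1 / 3) * (1 / 3) ^ Suc n)"
      by (intro sums_mult2 geometric_sums) simp
    have sum_tail: "summable (\<lambda>i. norm (f (i + Suc n) t))"
      by (rule summable_comparison_test'[OF sums_summable[OF S], of 0]) (use geo in simp)
    then have "summable (\<lambda>i. f i t)"
      using summable_norm_cancel summable_iff_shift by blast
    then have "l t - x (Suc n) t = (\<Sum>i. f (i + Suc n) t)"
      using x_eq[of "Suc n" t] suminf_minus_initial_segment[of "\<lambda>i. f i t" "Suc n"]
      by (simp only: l_def add_diff_cancel_left)
    also have "norm \<dots> \<le> (\<Sum>i. norm (f (i + Suc n) t))"
      using sum_tail by (rule summable_norm)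
    also have "\<dots> \<le> (\<Sum>i. (1 / 3 :: real) ^ i * (1 / 3) ^ Suc n)"
      using geo sum_tail sums_summable[OF S] by (rule suminf_le)
    also have "\<dots> = 1 / (2 * 3 ^ n)"
      using sums_unique[OF S] by (simp add: power_one_over)
    finally show ?thesis .
  qed
  have Ql: "real n + 1 < Q (h n) l" for n
  proof -
    define e where "e t = l t - x (Suc n) t" for t
    have "norm (e (h n) - e 0) / \<bar>h n\<bar> \<le> 1 / (2 * 3 ^ n) * N n"
      using Q_le_N tail unfolding Q_def e_def
      by (intro scaled_quotient_le[where n=n]) (auto intro: diff lW xW)
    moreover have "norm (x (Suc n) (h n) - x (Suc n) 0) \<le> norm (l (h n) - l 0) + norm (e (h n) - e 0)"
      using norm_triangle_ineq4[of "l (h n) - l 0" "e (h n) - e 0"] by (simp add: e_def)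
    then have "Q (h n) (x (Suc n)) \<le> Q (h n) l + norm (e (h n) - e 0) / \<bar>h n\<bar>"
      by (simp add: Q_def divide_right_mono flip: add_divide_distrib)
    ultimately have "2 / 3 * N n / 3 ^ n < Q (h n) l + N n / (2 * 3 ^ n)"
      using Qx[of n] by simp
    then have "N n / (6 * 3 ^ n) < Q (h n) l" by (simp add: field_simps)
    moreover have "real n + 1 < N n / (6 * 3 ^ n)" using N_large[of n] by (simp add: field_simps)
    ultimately show ?thesis by linarith
  qed
  obtain M where "\<And>h. 0 < \<bar>h\<bar> \<Longrightarrow> \<bar>h\<bar> \<le> 1 \<Longrightarrow> Q h l \<le> M"
    using difference_quotient_bounded[OF continuous[OF lW] differentiable_at_0[OF lW]]
    unfolding Q_def by blast
  then have "real n + 1 < M" for n using Ql[of n] h[of n] by (meson less_le_trans)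
  then show False using reals_Archimedean2[of M] by (metis add_increasing2 less_imp_le not_less zero_le_one)
qed

lemma difference_quotient_uniform_bound:
  obtains R C where "0 \<le> R" "0 < C"
    "\<And>y B h. y \<in> W \<Longrightarrow> 0 < B \<Longrightarrow> (\<And>t. t \<in> {-R..R} \<Longrightarrow> norm (y t) \<le> B) \<Longrightarrow>
       0 < \<bar>h\<bar> \<Longrightarrow> \<bar>h\<bar> \<le> 1 \<Longrightarrow> norm (y h - y 0) / \<bar>h\<bar> \<le> C * B"
proof -
  obtain n C where C: "\<And>z h. z \<in> unit_ball n \<Longrightarrow> 0 < \<bar>h\<bar> \<Longrightarrow> \<bar>h\<bar> \<le> 1 \<Longrightarrow>
      norm (z h - z 0) / \<bar>h\<bar> \<le> C"
    using unit_ball_quotients_bounded by blast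
  show thesis
  proof (rule that[of "real (Suc n)" "max C 1"])
    fix y B and h :: real
    assume "y \<in> W" "0 < B" "\<And>t. t \<in> {-real (Suc n)..real (Suc n)} \<Longrightarrow> norm (y t) \<le> B"
      and h: "0 < \<bar>h\<bar>" "\<bar>h\<bar> \<le> 1"
    moreover have "norm (z h - z 0) / \<bar>h\<bar> \<le> max C 1" if "z \<in> unit_ball n" for z
      using C[OF that h] by simp
    ultimately have "norm (y h - y 0) / \<bar>h\<bar> \<le> B * max C 1"
      by (intro scaled_quotient_le)
    then show "norm (y h - y 0) / \<bar>h\<bar> \<le> max C 1 * B" by (simp add: mult.commute)
  qed auto
qed

section \<open>Smoothness of the members of the space\<close>

lemma differentiable_at:
  assumes "y \<in> W" shows "y differentiable (at s)"
proof -
  have "(\<lambda>t. y (t + s)) differentiable (at 0)"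
    using assms by (intro differentiable_at_0 translate)
  then have "(\<lambda>t. y (t + s)) differentiable (at (s + - s))" by simp
  then have "((\<lambda>t. y (t + s)) \<circ> (\<lambda>t. t + - s)) differentiable (at s)"
    by (intro differentiable_chain_at) (auto intro!: derivative_intros)
  then show ?thesis by (simp add: o_def)
qed

abbreviation derivative :: "(real \<Rightarrow> 'a) \<Rightarrow> real \<Rightarrow> 'a"
  where "derivative y \<equiv> \<lambda>s. vector_derivative y (at s)"

lemma has_vector_derivative_derivative:
  "y \<in> W \<Longrightarrow> (y has_vector_derivative derivative y s) (at s)"
  using differentiable_at vector_derivative_works by blast

lemma slope_tendsto_derivative:
  assumes "y \<in> W"
  shows "((\<lambda>h. (y (s + h) - y s) /\<^sub>R h) \<longlongrightarrow> derivative y s) (at 0)"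
  by (intro has_vector_derivative_imp_slope_tendsto has_vector_derivative_derivative assms)

text \<open>
  The difference \<open>w\<close> of two translates of \<open>y\<close> lies in \<open>W\<close> and is uniformly small on \<open>[-R, R]\<close>
  if the shifts are close, by uniform continuity of \<open>y\<close> on compact intervals. The uniform bound on
  difference quotients turns this into smallness of \<open>w' 0\<close>, the difference of two values of \<open>y'\<close>.
\<close>

lemma continuous_on_derivative:
  assumes y: "y \<in> W"
  shows "continuous_on UNIV (derivative y)"
proof -
  obtain R C where R: "0 \<le> R" and C: "0 < C"
    and RC: "\<And>y B h. y \<in> W \<Longrightarrow> 0 < B \<Longrightarrow> (\<And>t. t \<in> {-R..R} \<Longrightarrow> norm (y t) \<le> B) \<Longrightarrow>
       0 < \<bar>h\<bar> \<Longrightarrow> \<bar>h\<bar> \<le> 1 \<Longrightarrow> norm (y h - y 0) / \<bar>h\<bar> \<le> C * B"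
    using difference_quotient_uniform_bound by blast
  have "\<exists>\<delta>>0. \<forall>s. dist s s0 < \<delta> \<longrightarrow> dist (derivative y s) (derivative y s0) \<le> e"
    if e: "0 < e" for e s0
  proof -
    have "uniformly_continuous_on {s0 - R - 1..s0 + R + 1} y"
      using continuous[OF y] by (intro compact_uniformly_continuous) (auto intro: continuous_on_subset)
    moreover have "0 < e / C" using e C by simp
    ultimately obtain \<delta> where \<delta>: "0 < \<delta>"
      and uc: "\<And>a b. a \<in> {s0 - R - 1..s0 + R + 1} \<Longrightarrow> b \<in> {s0 - R - 1..s0 + R + 1} \<Longrightarrow>
         dist a b < \<delta> \<Longrightarrow> dist (y a) (y b) < e / C"
      unfolding uniformly_continuous_on_def by metis
    show ?thesis
    proof (intro exI[of _ "min \<delta> 1"] conjI allI impI)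
      fix s assume s: "dist s s0 < min \<delta> 1"
      define w where "w t = y (t + s) - y (t + s0)" for t
      have "w \<in> W" unfolding w_def using y by (intro diff translate)
      moreover have "norm (w t) \<le> e / C" if "t \<in> {-R..R}" for t
      proof -
        have "t + s \<in> {s0 - R - 1..s0 + R + 1}" "t + s0 \<in> {s0 - R - 1..s0 + R + 1}"
          using s that by (auto simp: dist_real_def abs_less_iff)
        then have "dist (y (t + s)) (y (t + s0)) < e / C"
          using s by (intro uc) (auto simp: dist_real_def)
        then show ?thesis by (simp add: w_def dist_norm)
      qed
      ultimately have bound: "norm (w h - w 0) / \<bar>h\<bar> \<le> C * (e / C)" if "0 < \<bar>h\<bar>" "\<bar>h\<bar> \<le> 1" for h
        using RC[of w "e / C" h] that e C by simp
      have "((\<lambda>h. (y (s + h) - y s) /\<^sub>R h - (y (s0 + h) - y s0) /\<^sub>R h) \<longlongrightarrow>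
          derivative y s - derivative y s0) (at 0)"
        by (intro tendsto_diff slope_tendsto_derivative y)
      moreover have "eventually (\<lambda>h::real. norm ((y (s + h) - y s) /\<^sub>R h - (y (s0 + h) - y s0) /\<^sub>R h) \<le> e) (at 0)"
        unfolding eventually_at
      proof (intro exI[of _ 1] conjI ballI impI)
        fix h :: real assume "h \<noteq> 0 \<and> dist h 0 < 1"
        then have "norm (w h - w 0) / \<bar>h\<bar> \<le> e" using bound[of h] C by simp
        moreover have "(y (s + h) - y s) /\<^sub>R h - (y (s0 + h) - y s0) /\<^sub>R h = (w h - w 0) /\<^sub>R h"
          by (simp add: w_def algebra_simps)
        ultimately show "norm ((y (s + h) - y s) /\<^sub>R h - (y (s0 + h) - y s0) /\<^sub>R h) \<le> e"
          by (simp add: divide_inverse mult.commute)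
      qed simp
      ultimately show "dist (derivative y s) (derivative y s0) \<le> e"
        unfolding dist_norm by (intro Lim_norm_ubound) auto
    qed (use \<delta> in auto)
  qed
  then show ?thesis
    unfolding continuous_on_iff by (metis UNIV_I dense order_le_less_trans)
qed

text \<open>
  Once \<open>y'\<close> is known to be continuous, the mean value inequality shows that the difference
  quotients of \<open>y\<close> converge to it locally uniformly.
\<close>

lemma derivative_mem:
  assumes y: "y \<in> W"
  shows "derivative y \<in> W"
proof (rule limit)
  let ?k = "\<lambda>n::nat. 1 / real (Suc n)"
  define q where "q n t = (y (t + ?k n) - y t) /\<^sub>R ?k n" for n t
  show "q n \<in> W" for n
    unfolding q_def using y by (intro scale diff translate)
  show "uniform_limit {-T..T} q (derivative y) sequentially" for T
  proof (rule uniform_limitI)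
    fix e :: real assume e: "0 < e"
    have "uniformly_continuous_on {-T..T + 1} (derivative y)"
      using continuous_on_derivative[OF y]
      by (intro compact_uniformly_continuous) (auto intro: continuous_on_subset)
    then obtain \<delta> where \<delta>: "0 < \<delta>"
      and uc: "\<And>a b. a \<in> {-T..T + 1} \<Longrightarrow> b \<in> {-T..T + 1} \<Longrightarrow>
         dist a b < \<delta> \<Longrightarrow> dist (derivative y a) (derivative y b) < e / 2"
      unfolding uniformly_continuous_on_def using e by (metis half_gt_zero)
    have "eventually (\<lambda>n. ?k n < \<delta>) sequentially"
      using order_tendstoD(2)[OF LIMSEQ_inverse_real_of_nat \<delta>] by (simp add: divide_inverse)
    then show "eventually (\<lambda>n. \<forall>t\<in>{-T..T}. dist (q n t) (derivative y t) < e) sequentially"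
    proof (eventually_elim, intro ballI)
      fix n t assume n: "?k n < \<delta>" and t: "t \<in> {-T..T}"
      define k where "k = ?k n"
      have k: "0 < k" "k \<le> 1" "k < \<delta>" using n by (auto simp: k_def)
      have "norm (y (t + k) - y t - (t + k - t) *\<^sub>R derivative y t) \<le> norm (t + k - t) * (e / 2)"
      proof (rule vector_differentiable_bound_linearization[where S="{t..t + k}"])
        fix x assume "x \<in> {t..t + k}"
        then have "dist (derivative y x) (derivative y t) < e / 2"
          using t k by (intro uc) (auto simp: dist_real_def)
        then show "norm (derivative y x - derivative y t) \<le> e / 2" by (simp add: dist_norm)
      qed (use k in \<open>auto simp: closed_segment_eq_real_ivl
            intro: has_vector_derivative_at_within has_vector_derivative_derivative[OF y]\<close>)
      then have "norm (y (t + k) - y t - k *\<^sub>R derivative y t) / k \<le> e / 2"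
        using k by (simp add: pos_divide_le_eq mult.commute)
      moreover have "q n t = (y (t + k) - y t) /\<^sub>R k" by (simp only: q_def k_def)
      then have "q n t - derivative y t = (y (t + k) - y t - k *\<^sub>R derivative y t) /\<^sub>R k"
        using k by (simp add: scaleR_diff_right)
      then have "dist (q n t) (derivative y t) = norm (y (t + k) - y t - k *\<^sub>R derivative y t) / k"
        using k by (simp add: dist_norm divide_inverse mult.commute)
      ultimately show "dist (q n t) (derivative y t) < e"
        using e by linarith
    qed
  qed
qed

theorem infinitely_differentiable:
  assumes "y \<in> W" shows "infinitely_differentiable y"
proof -
  have "((\<lambda>f s. vector_derivative f (at s)) ^^ n) y \<in> W" for n
    by (induction n) (use assms derivative_mem in auto)
  then show ?thesis
    unfolding infinitely_differentiable_def using differentiable_at by blast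
qed

end

section \<open>The space of weak solutions\<close>

lemma bounded_clinear_adjoint_op:
  assumes "densely_defined D" "g \<in> adjoint_domain D A"
  shows "bounded_clinear (adjoint_op D A g)"
  using assms adjoint_op_eqI[of D] unfolding adjoint_domain_def by (smt (verit, best) mem_Collect_eq)

text \<open>
  For \<open>g\<close> in the domain of the adjoint, the functions \<open>g \<circ> u n\<close> converge, and so do their
  derivatives \<open>adjoint_op D A g \<circ> u n\<close>, locally uniformly because \<open>adjoint_op D A g\<close> is bounded. The
  theorem on differentiating a limit applies on a compact interval around \<open>t\<close>.
\<close>

lemma weak_solution_limit:
  fixes D :: "'a::complex_normed_vector set"
  assumes dense: "densely_defined D"
    and u: "\<And>n. weak_solution D A (u n)"
    and lim: "\<And>T. uniform_limit {-T..T} u y sequentially"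
  shows "weak_solution D A y"
  unfolding weak_solution_def
proof (intro conjI ballI allI)
  have cont: "continuous_on {-T..T} y" for T
    by (rule uniform_limit_theorem[OF _ lim])
      (use u in \<open>auto simp: weak_solution_def intro!: always_eventually intro: continuous_on_subset\<close>)
  have "isCont y t" for t
    using continuous_on_interior[OF cont[of "\<bar>t\<bar> + 1"], of t] by (simp add: abs_if)
  then show "continuous_on UNIV y" by (simp add: continuous_on_eq_continuous_at)
  fix g and t :: real assume g: "g \<in> adjoint_domain D A"
  have "bounded_linear g"
    using g by (simp add: adjoint_domain_def bounded_clinear_def)
  then interpret g: bounded_linear g .
  have "bounded_linear (adjoint_op D A g)"
    using bounded_clinear_adjoint_op[OF dense g] by (simp add: bounded_clinear_def)
  then interpret h: bounded_linear "adjoint_op D A g" .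
  let ?h = "adjoint_op D A g" and ?T = "\<bar>t\<bar> + 1"
  have pointwise: "(\<lambda>n. u n s) \<longlonglongrightarrow> y s" for s
    by (rule tendsto_uniform_limitI[OF lim[of "\<bar>s\<bar>"]]) (simp, linarith)
  have "\<exists>f. \<forall>s\<in>{-?T..?T}. (\<lambda>n. g (u n s)) \<longlonglongrightarrow> f s \<and>
      (f has_derivative (\<lambda>x. x *\<^sub>R ?h (y s))) (at s within {-?T..?T})"
  proof (rule has_derivative_sequence)
    show "((\<lambda>s. g (u n s)) has_derivative (\<lambda>x. x *\<^sub>R ?h (u n s))) (at s within {-?T..?T})" for n s
      using u[of n] g by (auto simp: weak_solution_def has_vector_derivative_def
          intro: has_derivative_at_withinI)
    show "(\<lambda>n. g (u n t)) \<longlonglongrightarrow> g (y t)" by (intro g.tendsto pointwise)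
    fix e :: real assume e: "0 < e"
    have "uniform_limit {-?T..?T} (\<lambda>n s. ?h (u n s)) (\<lambda>s. ?h (y s)) sequentially"
      using lim by (rule h.uniform_limit)
    from uniform_limitD[OF this e]
    show "eventually (\<lambda>n. \<forall>s\<in>{-?T..?T}. \<forall>x. norm (x *\<^sub>R ?h (u n s) - x *\<^sub>R ?h (y s)) \<le> e * norm x) sequentially"
      by eventually_elim
        (auto simp: dist_norm mult.commute[of e] intro!: mult_left_mono intro: less_imp_le
          simp del: scaleR_conv_of_real simp flip: scaleR_diff_right)
  qed auto
  then obtain f where f: "\<And>s. s \<in> {-?T..?T} \<Longrightarrow> (\<lambda>n. g (u n s)) \<longlonglongrightarrow> f s"
    and f': "\<And>s. s \<in> {-?T..?T} \<Longrightarrow> (f has_vector_derivative ?h (y s)) (at s within {-?T..?T})"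
    unfolding has_vector_derivative_def by blast
  have t: "t \<in> {-?T<..<?T}" by auto
  have f_eq: "f s = g (y s)" if "s \<in> {-?T..?T}" for s
    using LIMSEQ_unique[OF f[OF that] g.tendsto[OF pointwise]] .
  have "((\<lambda>s. g (y s)) has_vector_derivative ?h (y t)) (at t within {-?T..?T})"
    by (rule has_vector_derivative_transform[OF _ _ f']) (use f_eq t in auto)
  then have "((\<lambda>s. g (y s)) has_vector_derivative ?h (y t)) (at t within {-?T<..<?T})"
    by (rule has_vector_derivative_within_subset) auto
  then show "((\<lambda>s. g (y s)) has_vector_derivative ?h (y t)) (at t)"
    by (simp only: has_vector_derivative_within_open[OF t open_greaterThanLessThan])
qed

lemma translation_invariant_space_weak_solutions:
  fixes D :: "'a::complex_banach set"
  assumes dense: "densely_defined D"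
    and diff: "\<And>y. weak_solution D A y \<Longrightarrow> y differentiable (at 0)"
  shows "translation_invariant_space {y. weak_solution D A y}"
proof
  have lin: "bounded_linear g" "bounded_linear (adjoint_op D A g)" if "g \<in> adjoint_domain D A" for g
    using that bounded_clinear_adjoint_op[OF dense that]
    by (auto simp: adjoint_domain_def bounded_clinear_def)
  show "(\<lambda>t. 0) \<in> {y. weak_solution D A y}"
    using lin by (auto simp: weak_solution_def linear_0[OF bounded_linear.linear])
  show "(\<lambda>t. a *\<^sub>R y t + b *\<^sub>R z t) \<in> {y. weak_solution D A y}"
    if "y \<in> {y. weak_solution D A y}" "z \<in> {y. weak_solution D A y}" for y z a b
  proof -
    have yz: "weak_solution D A y" "weak_solution D A z" using that by simp_all
    have "((\<lambda>t. g (a *\<^sub>R y t + b *\<^sub>R z t)) has_vector_derivative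
        adjoint_op D A g (a *\<^sub>R y t + b *\<^sub>R z t)) (at t)" if g: "g \<in> adjoint_domain D A" for g t
    proof -
      have "((\<lambda>t. a *\<^sub>R g (y t) + b *\<^sub>R g (z t)) has_vector_derivative
          a *\<^sub>R adjoint_op D A g (y t) + b *\<^sub>R adjoint_op D A g (z t)) (at t)"
        using yz g unfolding weak_solution_def
        by (intro has_vector_derivative_add bounded_linear.has_vector_derivative[OF bounded_linear_scaleR_right])
          auto
      then show ?thesis
        using lin[OF g] by (simp add: linear_add[OF bounded_linear.linear]
            linear_scale[OF bounded_linear.linear] del: scaleR_conv_of_real)
    qed
    then show ?thesis using yz by (auto simp: weak_solution_def intro!: continuous_intros)
  qed
  show "(\<lambda>t. y (t + s)) \<in> {y. weak_solution D A y}" if "y \<in> {y. weak_solution D A y}" for y s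
  proof -
    have y: "weak_solution D A y" using that by simp
    have "((\<lambda>r. g (y (r + s))) has_vector_derivative adjoint_op D A g (y (t + s))) (at t)"
      if "g \<in> adjoint_domain D A" for g t
    proof -
      have "((\<lambda>r. r + s) has_vector_derivative 1) (at t)"
        by (auto intro!: derivative_eq_intros)
      moreover have "((\<lambda>r. g (y r)) has_vector_derivative adjoint_op D A g (y (t + s))) (at (t + s))"
        using y that by (simp add: weak_solution_def)
      ultimately show ?thesis using vector_diff_chain_at by (fastforce simp: o_def)
    qed
    moreover have "continuous_on UNIV (\<lambda>t. y (t + s))"
      using y by (auto simp: weak_solution_def intro!: continuous_on_compose2[of UNIV y] continuous_intros)
    ultimately show ?thesis by (simp add: weak_solution_def)
  qed
  show "y \<in> {y. weak_solution D A y}"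
    if "\<And>n. u n \<in> {y. weak_solution D A y}" "\<And>T. uniform_limit {-T..T} u y sequentially" for u y
    using that by (auto intro: weak_solution_limit[OF dense])
qed (use diff in \<open>auto simp: weak_solution_def\<close>)

theorem proposition7p1:
  fixes D :: "'a::complex_banach set" and A :: "'a \<Rightarrow> 'a"
  assumes "scalar_type_spectral_operator D A"
    and "\<And>y. weak_solution D A y \<Longrightarrow> y differentiable (at 0)"
  shows "\<forall>y. weak_solution D A y \<longrightarrow> infinitely_differentiable y"
proof -
  have "densely_defined D" using assms(1) by (simp add: scalar_type_spectral_operator_def)
  then have "translation_invariant_space {y. weak_solution D A y}"
    using assms(2) by (rule translation_invariant_space_weak_solutions)
  from translation_invariant_space.infinitely_differentiable[OF this] show ?thesis by simp
qed

end
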